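(* Let $y=\mathbf{x}'\beta_0+e$ be a linear regression model, where $\mathbf{x}$ is a random vector in $\mathbb{R}^p$, $\beta_0\in\mathbb{R}^p$, and the error $e$ is independent of $\mathbf{x}$ and is centered and symmetrically distributed with variance $\sigma^2$; let $H_0$ be the joint distribution of $(\mathbf{x},y)$. Let $\rho,J:\mathbb{R}\to\mathbb{R}$ be twice differentiable functions and put $\psi:=\rho'$. Then, for $\lambda\ge0$, the influence function of the penalized M-functional $\beta_M$ is $$IF((\mathbf{x}_0,y_0),\beta_M,H_0)=\Big(\mathbb{E}_{H_0}\big[\psi'(y-\mathbf{x}'\beta_M(H_0))\,\mathbf{x}\mathbf{x}'\big]+2\lambda\operatorname{diag}\big(J''(\beta_M(H_0))\big)\Big)^{-1}\Big(\psi(y_0-\mathbf{x}_0'\beta_M(H_0))\,\mathbf{x}_0-\mathbb{E}_{H_0}\big[\psi(y-\mathbf{x}'\beta_M(H_0))\,\mathbf{x}\big]\Big)$$ for $\mathbf{x}_0\in\mathbb{R}^p$, $y_0\in\mathbb{R}$.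
   Context: For a joint distribution $H$ of $(\mathbf{x},y)\in\mathbb{R}^p\times\mathbb{R}$, the penalized M-functional with loss $\rho$, penalty $J$ and penalty parameter $\lambda$ is $$\beta_M(H)=\operatorname*{arg\,min}_{\beta\in\mathbb{R}^p}\ \mathbb{E}_H\big[\rho(y-\mathbf{x}'\beta)\big]+2\lambda\sum_{j=1}^pJ(\beta_j).$$ The influence function of a functional $\beta(\cdot)$ at a distribution $H$ is $$IF((\mathbf{x}_0,y_0),\beta,H)=\frac{\partial}{\partial\epsilon}\Big[\beta\big((1-\epsilon)H+\epsilon\,\delta_{(\mathbf{x}_0,y_0)}\big)\Big]\Big|_{\epsilon=0},$$ where $\delta_{(\mathbf{x}_0,y_0)}$ is the point mass at $(\mathbf{x}_0,y_0)$. For $\beta\in\mathbb{R}^p$, $\operatorname{diag}(J''(\beta))$ denotes the $p\times p$ diagonal matrix with diagonal entries $J''(\beta_1),\dots,J''(\beta_p)$. A prime on a vector denotes transposition.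
   Formalization: Added: minimizers (of finite expected loss) exist for small ε; β_M is continuous in ε at 0; E[ψ(y−x'β_M)x] is finite; ψ'(y−x'c)|x|² is dominated by an integrable function for c near β_M(H_0); the inverted matrix is invertible. The derivative at ε=0 is right-sided. *)

theory Defs
  imports "HOL-Probability.Probability"
begin

text \<open>The mixture (1 - eps) H + eps delta_z. It is a probability measure only for eps in [0,1].\<close>

definition contaminated :: "'a measure \<Rightarrow> 'a \<Rightarrow> real \<Rightarrow> 'a measure" where
  "contaminated H z eps = measure_of (space H) (sets H)
     (\<lambda>A. ennreal (1 - eps) * emeasure H A + ennreal eps * emeasure (return H z) A)"

lemma space_contaminated [simp]: "space (contaminated H z eps) = space H"
  by (simp add: contaminated_def space_measure_of_conv)

lemma sets_contaminated [simp, measurable_cong]: "sets (contaminated H z eps) = sets H"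
  by (simp add: contaminated_def)

text \<open>The set function in the definition is countably additive, so \<^const>\<open>measure_of\<close> does not
  collapse to the null measure.\<close>

lemma emeasure_contaminated:
  assumes "A \<in> sets H"
  shows "emeasure (contaminated H z eps) A =
    ennreal (1 - eps) * emeasure H A + ennreal eps * emeasure (return H z) A"
  unfolding contaminated_def
proof (rule emeasure_measure_of_sigma)
  let ?m = "\<lambda>A. ennreal (1 - eps) * emeasure H A + ennreal eps * emeasure (return H z) A"
  show "sigma_algebra (space H) (sets H)" ..
  show "positive (sets H) ?m" by (simp add: positive_def)
  show "countably_additive (sets H) ?m"
  proof (rule countably_additiveI)
    fix F :: "nat \<Rightarrow> _"
    assume F: "range F \<subseteq> sets H" "disjoint_family F"
    have "(\<Sum>i. ?m (F i)) = (\<Sum>i. ennreal (1 - eps) * emeasure H (F i)) +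
        (\<Sum>i. ennreal eps * emeasure (return H z) (F i))"
      by (rule suminf_add[symmetric]) auto
    also have "\<dots> = ennreal (1 - eps) * (\<Sum>i. emeasure H (F i)) +
        ennreal eps * (\<Sum>i. emeasure (return H z) (F i))"
      by simp
    also have "\<dots> = ?m (\<Union>i. F i)"
      using F by (simp only: suminf_emeasure sets_return)
    finally show "(\<Sum>i. ?m (F i)) = ?m (\<Union>i. F i)" .
  qed
  show "A \<in> sets H" by fact
qed

text \<open>The derivative at 0 is the one from the right, since the contaminated distribution is
  a probability measure only for nonnegative eps.\<close>

definition influence_function ::
    "('a measure \<Rightarrow> 'b::real_normed_vector) \<Rightarrow> 'a measure \<Rightarrow> 'a \<Rightarrow> 'b" where
  "influence_function T H z =
     vector_derivative (\<lambda>eps. T (contaminated H z eps)) (at 0 within {0..1})"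

definition M_objective ::
    "(real \<Rightarrow> real) \<Rightarrow> (real \<Rightarrow> real) \<Rightarrow> real \<Rightarrow> ((real^'p) \<times> real) measure \<Rightarrow> real^'p \<Rightarrow> real" where
  "M_objective rho J lam H b =
     (\<integral>(x, y). rho (y - x \<bullet> b) \<partial>H) + 2 * lam * (\<Sum>j\<in>UNIV. J (b $ j))"

text \<open>Points b at which the expected loss is finite. For a loss that is bounded below, the objective
  is infinite at all other points, whereas the Bochner integral there would be 0; hence minimization
  is restricted to this set.\<close>

definition M_domain ::
    "(real \<Rightarrow> real) \<Rightarrow> ((real^'p) \<times> real) measure \<Rightarrow> real^'p \<Rightarrow> bool" where
  "M_domain rho H b \<longleftrightarrow> integrable H (\<lambda>(x, y). rho (y - x \<bullet> b))"

definition is_M_minimizer ::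
    "(real \<Rightarrow> real) \<Rightarrow> (real \<Rightarrow> real) \<Rightarrow> real \<Rightarrow> ((real^'p) \<times> real) measure \<Rightarrow> real^'p \<Rightarrow> bool" where
  "is_M_minimizer rho J lam H b \<longleftrightarrow> is_arg_min (M_objective rho J lam H) (M_domain rho H) b"

text \<open>If there are several minimizers, this is an unspecified one of them.\<close>

definition beta_M ::
    "(real \<Rightarrow> real) \<Rightarrow> (real \<Rightarrow> real) \<Rightarrow> real \<Rightarrow> ((real^'p) \<times> real) measure \<Rightarrow> real^'p" where
  "beta_M rho J lam H = arg_min (M_objective rho J lam H) (M_domain rho H)"

definition outer_square :: "real^'p \<Rightarrow> real^'p^'p" where
  "outer_square x = (\<chi> i j. x $ i * x $ j)"

definition diag :: "real^'p \<Rightarrow> real^'p^'p" where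
  "diag v = (\<chi> i j. if i = j then v $ i else 0)"

end

theory Submission
  imports Defs
begin

text \<open>
  Write \<open>G c\<close> for the mean score \<open>E[\<psi>(y - x'c) x]\<close> under \<open>H0\<close>, \<open>s c = \<psi>(y0 - x0'c) x0\<close>
  for the score of the contaminating point, and \<open>P c\<close> for the penalty gradient
  \<open>2 \<lambda> (J'(c j))\<^sub>j\<close>. The M-estimate \<open>c \<epsilon>\<close> of the distribution contaminated with mass
  \<open>\<epsilon>\<close> minimizes an objective whose gradient is
  \<open>P - (1 - \<epsilon>) G - \<epsilon> s\<close>, so it satisfies the score equation
  \<open>(1 - \<epsilon>) G(c \<epsilon>) + \<epsilon> s(c \<epsilon>) = P(c \<epsilon>)\<close>. In terms of \<open>K = G - P\<close> this reads
  \<open>K(c \<epsilon>) = \<epsilon> (G - s)(c \<epsilon>)\<close>, and in particular \<open>K b = 0\<close>. Since \<open>c \<epsilon> \<rightarrow> b\<close> and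
  the derivative of \<open>K\<close> at \<open>b\<close> is \<open>- A\<close> with \<open>A = E[\<psi>'(y - x'b) x x'] + 2 \<lambda> diag (J''(b j))\<close>
  invertible, the left-hand side is \<open>- A (c \<epsilon> - b)\<close> up to \<open>o(c \<epsilon> - b)\<close> and the right-hand
  side is \<open>\<epsilon> (G b - s b)\<close> up to \<open>o(\<epsilon>)\<close>. Solving for \<open>(c \<epsilon> - b) / \<epsilon>\<close> gives the limit
  \<open>A\<^sup>-\<^sup>1 (s b - G b)\<close>.

  Two points need care. First, \<open>\<psi>'\<close> need not be continuous, so \<open>K\<close> is only known to be
  differentiable at \<open>b\<close>, not continuously differentiable, and the implicit function theorem is not
  applicable. It is replaced by \<open>has_vector_derivative_implicit_root\<close>, which differentiates a
  root curve that is already known to exist and to converge. Secondly, the expectations must be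
  differentiated under the integral sign (\<open>has_derivative_integral_dominated\<close>). This is done
  twice. The bound \<open>g\<close> on \<open>\<psi>'(y - x'c) |x|\<^sup>2\<close> gives the derivative of \<open>G\<close>. By the mean
  value inequality it also dominates the scores \<open>\<psi>(y - x'c) x\<close> for \<open>c\<close> in the whole ball around
  \<open>b\<close>. Hence the expected loss is finite and differentiable on that ball, which makes \<open>c \<epsilon>\<close> an
  interior minimum as soon as it has entered the ball.
\<close>

section \<open>Differentiation under the integral sign\<close>

text \<open>The derivative exists at every sample point, not just almost everywhere: this makes
  \<open>f' c z h\<close> a pointwise limit of difference quotients, hence measurable in \<open>z\<close>. The function is
  then Lipschitz in the parameter with constant \<open>g z\<close>, so that the
  linearization errors divided by the length of the increment are dominated by \<open>2 * g z\<close>.\<close>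

lemma has_derivative_integral_dominated:
  fixes f :: "'a::real_normed_vector \<Rightarrow> 'b \<Rightarrow> 'c::{banach,second_countable_topology}"
  assumes S: "open S" "convex S"
    and meas: "\<And>c. f c \<in> borel_measurable N"
    and deriv: "\<And>z c. c \<in> S \<Longrightarrow> ((\<lambda>c. f c z) has_derivative f' c z) (at c)"
    and dom: "AE z in N. \<forall>c\<in>S. onorm (f' c z) \<le> g z"
    and g: "integrable N g"
    and b: "b \<in> S" "integrable N (f b)"
    and c: "c \<in> S"
  shows "integrable N (f c)"
    and "integrable N (\<lambda>z. f' c z h)"
    and "((\<lambda>c. \<integral>z. f c z \<partial>N) has_derivative (\<lambda>h. \<integral>z. f' c z h \<partial>N)) (at c)"
proof -
  have lin: "bounded_linear (f' d z)" if "d \<in> S" for d z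
    using deriv[OF that] by (rule has_derivative_bounded_linear)
  have bound: "AE z in N. \<forall>c\<in>S. \<forall>h. norm (f' c z h) \<le> g z * norm h"
    using dom
    by eventually_elim
      (use lin in \<open>blast intro: order_trans[OF onorm] mult_right_mono norm_ge_zero\<close>)
  have lip: "AE z in N. \<forall>u\<in>S. \<forall>v\<in>S. norm (f u z - f v z) \<le> g z * norm (u - v)"
    using dom
  proof eventually_elim
    case (elim z)
    show ?case
    proof (intro ballI)
      fix u v assume uv: "u \<in> S" "v \<in> S"
      show "norm (f u z - f v z) \<le> g z * norm (u - v)"
      proof (rule differentiable_bound[OF S(2), where f' = "\<lambda>c. f' c z"])
        show "((\<lambda>c. f c z) has_derivative f' d z) (at d within S)" if "d \<in> S" for d
          using deriv[OF that] by (rule has_derivative_at_withinI)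
      qed (use uv elim in auto)
    qed
  qed
  have int: "integrable N (f d)" if "d \<in> S" for d
  proof -
    have "integrable N (\<lambda>z. f d z - f b z)"
    proof (rule Bochner_Integration.integrable_bound)
      show "integrable N (\<lambda>z. g z * norm (d - b))" using g by simp
      show "AE z in N. norm (f d z - f b z) \<le> norm (g z * norm (d - b))"
        using lip by eventually_elim (use that b in \<open>force intro: order_trans[OF _ abs_ge_self]\<close>)
    qed (use meas in simp)
    from Bochner_Integration.integrable_add[OF this b(2)] show ?thesis by simp
  qed
  show "integrable N (f c)" by (rule int[OF c])

  have meas': "(\<lambda>z. f' c z h) \<in> borel_measurable N" for h
  proof (rule borel_measurable_LIMSEQ_metric)
    let ?q = "\<lambda>n z. (f (c + (1 / real (Suc n)) *\<^sub>R h) z - f c z) /\<^sub>R (1 / real (Suc n))"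
    show "?q n \<in> borel_measurable N" for n
      using meas by simp
    fix z
    let ?k = "\<lambda>t. f (c + t *\<^sub>R h) z"
    have "((\<lambda>t. c + t *\<^sub>R h) has_derivative (\<lambda>t. t *\<^sub>R h)) (at 0)"
      by (auto intro!: derivative_eq_intros)
    from has_derivative_compose[OF this, of "\<lambda>c. f c z" "f' c z"] deriv[OF c, of z]
    have "(?k has_derivative (\<lambda>t. f' c z (t *\<^sub>R h))) (at 0)" by simp
    then have "(?k has_vector_derivative f' c z h) (at 0)"
      unfolding has_vector_derivative_def
      by (simp add: linear_cmul[OF bounded_linear.linear[OF lin[OF c]]])
    then have "((\<lambda>t. norm (?k t - ?k 0 - t *\<^sub>R f' c z h) / norm t) \<longlongrightarrow> 0) (at 0)"
      by (simp add: has_vector_derivative_def has_derivative_iff_norm)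
    then have "((\<lambda>t. norm ((?k t - ?k 0) /\<^sub>R t - f' c z h)) \<longlongrightarrow> 0) (at 0)"
    proof (rule Lim_transform_eventually)
      have "norm (u - t *\<^sub>R v) / norm t = norm (u /\<^sub>R t - v)" if "t \<noteq> 0" for t and u v :: 'c
      proof -
        have "u /\<^sub>R t - v = (u - t *\<^sub>R v) /\<^sub>R t"
          using that by (simp add: scaleR_diff_right)
        then show ?thesis by (simp add: divide_inverse mult.commute)
      qed
      then show "\<forall>\<^sub>F t in at 0. norm (?k t - ?k 0 - t *\<^sub>R f' c z h) / norm t
          = norm ((?k t - ?k 0) /\<^sub>R t - f' c z h)"
        by (simp add: eventually_at_filter)
    qed
    then have *: "((\<lambda>t. (?k t - ?k 0) /\<^sub>R t) \<longlongrightarrow> f' c z h) (at 0)"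
      by (simp add: tendsto_norm_zero_iff LIM_zero_iff)
    have "filterlim (\<lambda>n. 1 / real (Suc n)) (at 0) sequentially"
      unfolding filterlim_at using LIMSEQ_inverse_real_of_nat by (simp add: inverse_eq_divide)
    from filterlim_compose[OF * this] show "(\<lambda>n. ?q n z) \<longlonglongrightarrow> f' c z h"
      by simp
  qed
  have int': "integrable N (\<lambda>z. f' c z h)" for h
  proof (rule Bochner_Integration.integrable_bound)
    show "integrable N (\<lambda>z. g z * norm h)" using g by simp
    show "AE z in N. norm (f' c z h) \<le> norm (g z * norm h)"
      using bound by eventually_elim (use c in \<open>force intro: order_trans[OF _ abs_ge_self]\<close>)
  qed (rule meas')
  show "integrable N (\<lambda>z. f' c z h)" by (rule int')

  have "((\<lambda>c. \<integral>z. f c z \<partial>N) has_derivative (\<lambda>h. \<integral>z. f' c z h \<partial>N)) (at c within S)"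
    unfolding has_derivative_within tendsto_at_iff_sequentially
  proof (intro conjI allI impI)
    show "bounded_linear (\<lambda>h. \<integral>z. f' c z h \<partial>N)"
    proof (rule bounded_linear_intro[where K = "\<integral>z. g z \<partial>N"])
      fix h k :: 'a and r :: real
      show "(\<integral>z. f' c z (h + k) \<partial>N) = (\<integral>z. f' c z h \<partial>N) + (\<integral>z. f' c z k \<partial>N)"
        by (simp add: linear_add[OF bounded_linear.linear[OF lin[OF c]]] int')
      show "(\<integral>z. f' c z (r *\<^sub>R h) \<partial>N) = r *\<^sub>R (\<integral>z. f' c z h \<partial>N)"
        by (simp add: linear_cmul[OF bounded_linear.linear[OF lin[OF c]]])
      have "norm (\<integral>z. f' c z h \<partial>N) \<le> (\<integral>z. norm (f' c z h) \<partial>N)"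
        by (rule integral_norm_bound)
      also have "\<dots> \<le> (\<integral>z. g z * norm h \<partial>N)"
        using bound c by (intro integral_mono_AE) (auto simp: int' g)
      finally show "norm (\<integral>z. f' c z h \<partial>N) \<le> norm h * (\<integral>z. g z \<partial>N)"
        by (simp add: mult.commute)
    qed
    fix X assume X: "\<forall>i. X i \<in> S - {c}" "X \<longlonglongrightarrow> c"
    let ?q = "\<lambda>n z. (1 / norm (X n - c)) *\<^sub>R (f (X n) z - (f c z + f' c z (X n - c)))"
    have "(\<lambda>n. \<integral>z. ?q n z \<partial>N) \<longlonglongrightarrow> (\<integral>z. 0 \<partial>N)"
    proof (rule integral_dominated_convergence[where w = "\<lambda>z. 2 * g z"])
      show "?q n \<in> borel_measurable N" for n
        using meas meas' by simp
      show "AE z in N. (\<lambda>n. ?q n z) \<longlonglongrightarrow> 0"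
      proof (rule AE_I2)
        fix z
        have "((\<lambda>c. f c z) has_derivative f' c z) (at c within S)"
          using deriv[OF c] by (rule has_derivative_at_withinI)
        then show "(\<lambda>n. ?q n z) \<longlonglongrightarrow> 0"
          using X unfolding has_derivative_within tendsto_at_iff_sequentially
          by (auto simp: o_def)
      qed
      show "AE z in N. norm (?q n z) \<le> 2 * g z" for n
        using bound lip
      proof eventually_elim
        case (elim z)
        have XS: "X n \<in> S" and pos: "norm (X n - c) > 0" using X(1) by auto
        have "norm (f (X n) z - (f c z + f' c z (X n - c)))
            \<le> norm (f (X n) z - f c z) + norm (f' c z (X n - c))"
          by (metis diff_diff_add norm_triangle_ineq4)
        also have "\<dots> \<le> g z * norm (X n - c) + g z * norm (X n - c)"
          using elim c XS by (intro add_mono) blast+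
        finally show ?case
          using pos by (simp add: divide_simps ac_simps)
      qed
    qed (use g in simp_all)
    moreover have "(\<integral>z. ?q n z \<partial>N) = (1 / norm (X n - c)) *\<^sub>R
        ((\<integral>z. f (X n) z \<partial>N) - ((\<integral>z. f c z \<partial>N) + (\<integral>z. f' c z (X n - c) \<partial>N)))" for n
      using X(1) c int int' by auto
    ultimately show "((\<lambda>y. (1 / norm (y - c)) *\<^sub>R ((\<integral>z. f y z \<partial>N) -
        ((\<integral>z. f c z \<partial>N) + (\<integral>z. f' c z (y - c) \<partial>N)))) \<circ> X) \<longlonglongrightarrow> 0"
      by (simp only: o_def integral_zero)
  qed
  then show "((\<lambda>c. \<integral>z. f c z \<partial>N) has_derivative (\<lambda>h. \<integral>z. f' c z h \<partial>N)) (at c)"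
    using at_within_open[OF c S(1)] by simp
qed

section \<open>Differentiating a given root curve\<close>

text \<open>Applying the left inverse \<open>T\<close> to \<open>K (c t) = t *\<^sub>R r t\<close> gives
  \<open>c t - c 0 = t *\<^sub>R T (r t) - R (c t)\<close>, where \<open>R\<close> is \<open>T\<close> applied to the error of the
  linearization of \<open>K\<close>. This error is at first only known to be small relative to \<open>c t - c 0\<close>.
  Once its norm is at most half that of \<open>c t - c 0\<close>, it can be absorbed into the left-hand side, so
  \<open>c t - c 0\<close> is of order \<open>t\<close> and the error is small relative to \<open>t\<close> as well.\<close>

lemma has_vector_derivative_implicit_root:
  fixes K :: "'a::real_normed_vector \<Rightarrow> 'b::real_normed_vector"
  assumes K: "(K has_derivative A) (at (c 0))" "K (c 0) = 0"
    and T: "bounded_linear T" "\<And>h. T (A h) = h"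
    and c: "(c \<longlongrightarrow> c 0) (at 0 within S)"
    and root: "\<forall>\<^sub>F t in at 0 within S. K (c t) = t *\<^sub>R r t"
    and r: "(r \<longlongrightarrow> v) (at 0 within S)"
  shows "(c has_vector_derivative T v) (at 0 within S)"
  unfolding has_vector_derivative_def has_derivative_within_alt2
proof (intro conjI allI impI)
  interpret T: bounded_linear T by (rule T)
  show "bounded_linear (\<lambda>x. x *\<^sub>R T v)" by (rule bounded_linear_scaleR_left)
  define R where "R u = T (K u) - (u - c 0)" for u
  have small: "\<forall>\<^sub>F t in at 0 within S. norm (R (c t)) \<le> q * norm (c t - c 0)" if "q > 0" for q
  proof -
    have "((\<lambda>u. T (K u)) has_derivative (\<lambda>h. T (A h))) (at (c 0))"
      by (rule T.has_derivative[OF K(1)])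
    then have "\<forall>\<^sub>F u in at (c 0). norm (R u) \<le> q * norm (u - c 0)"
      using that K(2) unfolding has_derivative_within_alt2 R_def by (simp add: T.zero T(2))
    then have "\<forall>\<^sub>F u in nhds (c 0). norm (R u) \<le> q * norm (u - c 0)"
      unfolding eventually_at_filter
      by (rule eventually_mono) (auto simp: R_def K(2) T.zero)
    then show ?thesis
      using c by (rule eventually_compose_filterlim)
  qed
  have Tr: "((\<lambda>t. T (r t)) \<longlongrightarrow> T v) (at 0 within S)"
    by (rule T.tendsto[OF r])
  define B where "B = norm (T v) + 1"
  have B: "B > 0" unfolding B_def by (simp add: add_nonneg_pos)
  have "\<forall>\<^sub>F t in at 0 within S. norm (T (r t)) < B"
    by (rule order_tendstoD(2)[OF tendsto_norm[OF Tr]]) (simp add: B_def)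
  moreover have "\<forall>\<^sub>F t in at 0 within S. norm (R (c t)) \<le> 1 / 2 * norm (c t - c 0)"
    by (rule small) simp
  ultimately have lin_rate: "\<forall>\<^sub>F t in at 0 within S. norm (c t - c 0) \<le> 2 * B * \<bar>t\<bar>"
    using root
  proof eventually_elim
    case (elim t)
    have "norm (c t - c 0) \<le> norm (T (K (c t))) + norm (R (c t))"
      unfolding R_def by (metis diff_diff_eq2 add_diff_cancel_left' norm_triangle_ineq4)
    also have "norm (T (K (c t))) = \<bar>t\<bar> * norm (T (r t))"
      using elim by (simp add: T.scaleR)
    also have "\<dots> \<le> \<bar>t\<bar> * B" using elim by (intro mult_left_mono) auto
    finally show ?case using elim by (simp add: field_simps)
  qed
  \<comment> \<open>Split \<open>q\<close> into halves: one for \<open>T (r t) - T v\<close>, one for \<open>R (c t)\<close>, whose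
    coefficient \<open>q / (4 * B)\<close> offsets the rate \<open>2 * B\<close>.\<close>
  fix q :: real assume q: "q > 0"
  have "\<forall>\<^sub>F t in at 0 within S. dist (T (r t)) (T v) < q / 2"
    using Tr q by (intro tendstoD) auto
  moreover have "\<forall>\<^sub>F t in at 0 within S. norm (R (c t)) \<le> q / (4 * B) * norm (c t - c 0)"
    using q B by (intro small) simp
  ultimately show "\<forall>\<^sub>F t in at 0 within S.
      norm (c t - c 0 - (t - 0) *\<^sub>R T v) \<le> q * norm (t - 0)"
    using lin_rate root
  proof eventually_elim
    case (elim t)
    have "c t - c 0 - t *\<^sub>R T v = t *\<^sub>R (T (r t) - T v) - R (c t)"
      unfolding R_def using elim by (simp add: T.scaleR algebra_simps)
    then have "norm (c t - c 0 - t *\<^sub>R T v) \<le> \<bar>t\<bar> * norm (T (r t) - T v) + norm (R (c t))"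
      by (metis norm_scaleR norm_triangle_ineq4)
    also have "\<dots> \<le> \<bar>t\<bar> * (q / 2) + q / (4 * B) * (2 * B * \<bar>t\<bar>)"
    proof (rule add_mono)
      show "\<bar>t\<bar> * norm (T (r t) - T v) \<le> \<bar>t\<bar> * (q / 2)"
        using elim by (intro mult_left_mono) (auto simp: dist_norm)
      have "norm (R (c t)) \<le> q / (4 * B) * norm (c t - c 0)" using elim by simp
      also have "\<dots> \<le> q / (4 * B) * (2 * B * \<bar>t\<bar>)"
        using elim q B by (intro mult_left_mono) auto
      finally show "norm (R (c t)) \<le> q / (4 * B) * (2 * B * \<bar>t\<bar>)" .
    qed
    also have "\<dots> = q * \<bar>t\<bar>" using B by (simp add: field_simps)
    finally show ?case by simp
  qed
qed

section \<open>Integration with respect to a contaminated measure\<close>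

lemma nn_integral_contaminated:
  assumes f: "f \<in> borel_measurable H" and z: "z \<in> space H"
  shows "(\<integral>\<^sup>+x. f x \<partial>contaminated H z eps) =
    ennreal (1 - eps) * (\<integral>\<^sup>+x. f x \<partial>H) + ennreal eps * f z"
  using f
proof (induction rule: borel_measurable_induct)
  case (cong f g)
  have "(\<integral>\<^sup>+x. f x \<partial>contaminated H z eps) = (\<integral>\<^sup>+x. g x \<partial>contaminated H z eps)"
    "(\<integral>\<^sup>+x. f x \<partial>H) = (\<integral>\<^sup>+x. g x \<partial>H)"
    by (auto intro!: nn_integral_cong simp: cong(3))
  then show ?case using cong(3)[OF z] cong(4) by metis
next
  case (set A)
  then show ?case by (simp add: emeasure_contaminated)
next
  case (mult u c)
  then show ?case by (simp add: nn_integral_cmult distrib_left mult.left_commute)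
next
  case (add u v)
  then show ?case by (simp add: nn_integral_add distrib_left add_ac)
next
  case (seq U)
  have mono: "incseq (\<lambda>i. \<integral>\<^sup>+x. U i x \<partial>H)" "incseq (\<lambda>i. U i z)"
    using \<open>incseq U\<close> by (auto simp: incseq_def le_fun_def intro!: nn_integral_mono)
  have "(\<integral>\<^sup>+x. (\<Squnion>i. U i) x \<partial>contaminated H z eps)
      = (\<Squnion>i. \<integral>\<^sup>+x. U i x \<partial>contaminated H z eps)"
    using seq by (simp add: nn_integral_monotone_convergence_SUP image_comp)
  also have "\<dots> = (\<Squnion>i. ennreal (1 - eps) * (\<integral>\<^sup>+x. U i x \<partial>H) + ennreal eps * U i z)"
    using seq by simp
  also have "\<dots> = ennreal (1 - eps) * (\<Squnion>i. \<integral>\<^sup>+x. U i x \<partial>H) + ennreal eps * (\<Squnion>i. U i z)"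
    using mono by (subst ennreal_SUP_add)
      (auto simp: SUP_mult_left_ennreal incseq_def intro!: mult_left_mono)
  also have "(\<Squnion>i. \<integral>\<^sup>+x. U i x \<partial>H) = (\<integral>\<^sup>+x. (\<Squnion>i. U i) x \<partial>H)"
    using seq by (simp add: nn_integral_monotone_convergence_SUP image_comp)
  finally show ?case by (simp add: image_comp)
qed

lemma
  fixes f :: "'a \<Rightarrow> real"
  assumes f: "integrable H f" and z: "z \<in> space H" and eps: "0 \<le> eps" "eps \<le> 1"
  shows integrable_contaminated: "integrable (contaminated H z eps) f"
    and integral_contaminated:
      "(\<integral>x. f x \<partial>contaminated H z eps) = (1 - eps) * (\<integral>x. f x \<partial>H) + eps * f z"
proof -
  have m: "f \<in> borel_measurable H" using f by simp
  have m': "f \<in> borel_measurable (contaminated H z eps)"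
    using m by (simp cong: measurable_cong_sets)
  note nn = nn_integral_contaminated[OF _ z, of _ eps]
  have fin: "(\<integral>\<^sup>+x. ennreal (norm (f x)) \<partial>H) < \<infinity>"
    using f by (simp add: integrable_iff_bounded)
  show int: "integrable (contaminated H z eps) f"
    unfolding integrable_iff_bounded using m m' fin
    by (simp add: nn ennreal_mult_less_top)
  have part: "enn2real (\<integral>\<^sup>+x. ennreal (u x) \<partial>contaminated H z eps) =
      (1 - eps) * enn2real (\<integral>\<^sup>+x. ennreal (u x) \<partial>H) + eps * enn2real (ennreal (u z))"
    if u: "u \<in> borel_measurable H" "\<And>x. u x \<le> norm (f x)" for u
  proof -
    have "(\<integral>\<^sup>+x. ennreal (u x) \<partial>H) \<le> (\<integral>\<^sup>+x. ennreal (norm (f x)) \<partial>H)"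
      using u by (intro nn_integral_mono ennreal_leI) auto
    then have "(\<integral>\<^sup>+x. ennreal (u x) \<partial>H) < top" using fin by (simp add: le_less_trans)
    then show ?thesis
      using u eps by (simp add: nn enn2real_plus enn2real_mult ennreal_mult_less_top)
  qed
  show "(\<integral>x. f x \<partial>contaminated H z eps) = (1 - eps) * (\<integral>x. f x \<partial>H) + eps * f z"
    unfolding real_lebesgue_integral_def[OF int] real_lebesgue_integral_def[OF f]
    using part[of f] part[of "\<lambda>x. - f x"] m
    by (cases "f z \<ge> 0") (simp_all add: algebra_simps ennreal_neg)
qed

lemma contaminated_zero: "contaminated H z 0 = H"
  by (rule measure_eqI) (simp_all add: emeasure_contaminated)

section \<open>Outer products, diagonal matrices and inverses\<close>

lemma outer_square_mult: "outer_square x *v h = (x \<bullet> h) *\<^sub>R x"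
  by (simp add: outer_square_def matrix_vector_mult_def vec_eq_iff inner_vec_def
      sum_distrib_left sum_distrib_right mult_ac)

lemma diag_mult: "diag v *v h = (\<chi> j. v $ j * h $ j)"
  by (simp add: diag_def matrix_vector_mult_def vec_eq_iff if_distrib if_distribR cong: if_cong)

lemma matrix_vector_mult_uminus: "A *v (- x) = - (A *v x)" for A :: "real^'n^'m"
  by (rule linear_neg[OF matrix_vector_mul_linear])

lemma matrix_inv_mult_left: "invertible A \<Longrightarrow> matrix_inv A *v (A *v x) = x" for A :: "real^'n^'m"
  unfolding invertible_def matrix_inv_def
  by (drule someI_ex) (simp add: matrix_vector_mul_assoc)

lemma integral_matrix_vector_mult:
  fixes W :: "'a \<Rightarrow> real^'n^'m"
  assumes "integrable N W"
  shows "(\<integral>z. W z *v h \<partial>N) = (\<integral>z. W z \<partial>N) *v h"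
proof (rule integral_bounded_linear[OF _ assms])
  have "linear (\<lambda>A. A *v h :: real^'m)"
    by (rule linearI) (simp_all add: matrix_vector_mult_add_rdistrib scaleR_matrix_vector_assoc)
  then show "bounded_linear (\<lambda>A. A *v h :: real^'m)"
    by (rule linear_conv_bounded_linear[THEN iffD1])
qed

text \<open>An outer square is symmetric, so its products with the basis vectors are its
  rows, and the integrability of all matrix-vector products passes to the matrix.\<close>

lemma integrable_scaled_outer_square:
  fixes x :: "'a \<Rightarrow> real^'p"
  assumes "\<And>h. integrable N (\<lambda>z. (w z * (x z \<bullet> h)) *\<^sub>R x z)"
  shows "integrable N (\<lambda>z. w z *\<^sub>R outer_square (x z))"
proof -
  have row: "bounded_linear (axis i :: real^'p \<Rightarrow> real^'p^'p)" for i
    by (rule linear_conv_bounded_linear[THEN iffD1], rule linearI)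
      (auto simp: axis_def vec_eq_iff)
  have "integrable N (\<lambda>z. \<Sum>i\<in>UNIV. axis i ((w z * (x z \<bullet> axis i 1)) *\<^sub>R x z) :: real^'p^'p)"
    by (intro Bochner_Integration.integrable_sum integrable_bounded_linear[OF row] assms)
  also have "(\<lambda>z. \<Sum>i\<in>UNIV. axis i ((w z * (x z \<bullet> axis i 1)) *\<^sub>R x z) :: real^'p^'p)
      = (\<lambda>z. w z *\<^sub>R outer_square (x z))"
    unfolding inner_axis
    by (auto simp: fun_eq_iff vec_eq_iff outer_square_def axis_def if_distrib
        if_distribR cong: if_cong)
  finally show ?thesis .
qed

section \<open>The gradient of the expected loss\<close>

context
  fixes H :: "((real^'p) \<times> real) measure" and rho psi psi' :: "real \<Rightarrow> real"
    and b :: "real^'p" and delta :: real and g :: "(real^'p) \<times> real \<Rightarrow> real"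
  assumes sets_H: "sets H = sets borel"
    and rho: "\<And>t. (rho has_real_derivative psi t) (at t)"
    and psi: "\<And>t. (psi has_real_derivative psi' t) (at t)"
    and score: "integrable H (\<lambda>(x, y). psi (y - x \<bullet> b) *\<^sub>R x)"
    and delta: "delta > 0" and g: "integrable H g"
    and dominated: "AE (x, y) in H. \<forall>c\<in>ball b delta. \<bar>psi' (y - x \<bullet> c)\<bar> * (norm x)\<^sup>2 \<le> g (x, y)"
begin

lemma continuous_rho: "continuous_on UNIV rho" and continuous_psi: "continuous_on UNIV psi"
  using rho psi by (auto intro!: continuous_at_imp_continuous_on DERIV_isCont)

lemma measurable_if_continuous:
  "continuous_on UNIV f \<Longrightarrow> f \<in> borel_measurable H"
  for f :: "(real^'p) \<times> real \<Rightarrow> 'c::topological_space"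
  using borel_measurable_continuous_onI[of f] by (simp cong: measurable_cong_sets add: sets_H)

lemma measurable_score: "(\<lambda>z. psi (snd z - fst z \<bullet> c) *\<^sub>R fst z) \<in> borel_measurable H"
  by (intro measurable_if_continuous continuous_intros continuous_on_compose2[OF continuous_psi]) auto

lemma measurable_loss: "(\<lambda>z. rho (snd z - fst z \<bullet> c)) \<in> borel_measurable H"
  by (intro measurable_if_continuous continuous_intros continuous_on_compose2[OF continuous_rho]) auto

lemma score_has_derivative:
  "((\<lambda>c. psi (snd z - fst z \<bullet> c) *\<^sub>R fst z) has_derivative
    (\<lambda>h. - (psi' (snd z - fst z \<bullet> c) * (fst z \<bullet> h)) *\<^sub>R fst z)) (at c)"
  by (rule derivative_eq_intros DERIV_compose_FDERIV[OF psi] refl)+ (simp add: mult.commute)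

lemma loss_has_derivative:
  "((\<lambda>c. rho (snd z - fst z \<bullet> c)) has_derivative
    (\<lambda>h. - (psi (snd z - fst z \<bullet> c) *\<^sub>R fst z \<bullet> h))) (at c)"
proof -
  have "((\<lambda>c. snd z - fst z \<bullet> c) has_derivative (\<lambda>h. - (fst z \<bullet> h))) (at c)"
    by (auto intro!: derivative_eq_intros)
  from DERIV_compose_FDERIV[OF rho this] show ?thesis by (simp add: mult.commute)
qed

text \<open>The derivative of the score in \<open>c\<close> is \<open>- \<psi>'(y - x'c) x x'\<close>, and the operator norm
  of \<open>x x'\<close> is \<open>|x|\<^sup>2\<close>.\<close>

lemma onorm_score_derivative:
  "AE z in H. \<forall>c\<in>ball b delta.
    onorm (\<lambda>h. - (psi' (snd z - fst z \<bullet> c) * (fst z \<bullet> h)) *\<^sub>R fst z) \<le> g z"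
  using dominated
proof eventually_elim
  case (elim z)
  show ?case
  proof (intro ballI onorm_le)
    fix c h assume c: "c \<in> ball b delta"
    have "norm (- (psi' (snd z - fst z \<bullet> c) * (fst z \<bullet> h)) *\<^sub>R fst z)
        = \<bar>psi' (snd z - fst z \<bullet> c)\<bar> * norm (fst z) * \<bar>fst z \<bullet> h\<bar>"
      by (simp add: abs_mult)
    also have "\<dots> \<le> \<bar>psi' (snd z - fst z \<bullet> c)\<bar> * norm (fst z) * (norm (fst z) * norm h)"
      by (intro mult_left_mono Cauchy_Schwarz_ineq2) simp
    also have "\<dots> = \<bar>psi' (snd z - fst z \<bullet> c)\<bar> * (norm (fst z))\<^sup>2 * norm h"
      by (simp add: power2_eq_square)
    also have "\<dots> \<le> g z * norm h"
      using elim c by (intro mult_right_mono) (auto simp: case_prod_beta)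
    finally show "norm (- (psi' (snd z - fst z \<bullet> c) * (fst z \<bullet> h)) *\<^sub>R fst z) \<le> g z * norm h" .
  qed
qed

lemmas mean_score = has_derivative_integral_dominated[OF open_ball convex_ball measurable_score
  score_has_derivative onorm_score_derivative g, of b]

lemma mean_score_has_derivative:
  "((\<lambda>c. \<integral>(x, y). psi (y - x \<bullet> c) *\<^sub>R x \<partial>H) has_derivative
    (\<lambda>h. - ((\<integral>(x, y). psi' (y - x \<bullet> b) *\<^sub>R outer_square x \<partial>H) *v h))) (at b)"
proof -
  have b: "b \<in> ball b delta" using delta by simp
  note sc = score[unfolded case_prod_beta']
  have "integrable H (\<lambda>z. (psi' (snd z - fst z \<bullet> b) * (fst z \<bullet> h)) *\<^sub>R fst z)" for h
    using mean_score(2)[OF b sc b, of h] by simp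
  then have int: "integrable H (\<lambda>z. psi' (snd z - fst z \<bullet> b) *\<^sub>R outer_square (fst z))"
    by (rule integrable_scaled_outer_square)
  have "(\<integral>z. - (psi' (snd z - fst z \<bullet> b) * (fst z \<bullet> h)) *\<^sub>R fst z \<partial>H)
      = - ((\<integral>z. psi' (snd z - fst z \<bullet> b) *\<^sub>R outer_square (fst z) \<partial>H) *v h)" for h
    unfolding integral_matrix_vector_mult[OF int, symmetric]
    by (simp add: outer_square_mult flip: scaleR_matrix_vector_assoc)
  then show ?thesis
    using mean_score(3)[OF b sc b] by (simp add: case_prod_beta')
qed

text \<open>The derivative of the loss is dominated because the score is Lipschitz in the parameter
  with constant \<open>g\<close>: on the ball its norm is at most that of its value at \<open>b\<close> plus
  \<open>g * delta\<close>.\<close>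

lemma expected_loss_has_derivative:
  assumes dom: "M_domain rho H b" and c: "c \<in> ball b delta"
  shows "M_domain rho H c"
    and "((\<lambda>c. \<integral>(x, y). rho (y - x \<bullet> c) \<partial>H) has_derivative
      (\<lambda>h. - ((\<integral>(x, y). psi (y - x \<bullet> c) *\<^sub>R x \<partial>H) \<bullet> h))) (at c)"
proof -
  have b: "b \<in> ball b delta" using delta by simp
  let ?G = "\<lambda>z. norm (psi (snd z - fst z \<bullet> b) *\<^sub>R fst z) + g z * delta"
  note sc = score[unfolded case_prod_beta']
  have G: "integrable H ?G"
    by (intro Bochner_Integration.integrable_add integrable_norm sc integrable_mult_left g)
  have onorm: "AE z in H. \<forall>c\<in>ball b delta.
      onorm (\<lambda>h. - (psi (snd z - fst z \<bullet> c) *\<^sub>R fst z \<bullet> h)) \<le> ?G z"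
    using onorm_score_derivative
  proof eventually_elim
    case (elim z)
    show ?case
    proof (intro ballI onorm_le)
      fix c h assume c: "c \<in> ball b delta"
      have g0: "0 \<le> g z"
        using elim b has_derivative_bounded_linear[OF score_has_derivative]
        by (blast intro: order_trans[OF onorm_pos_le])
      have "norm (psi (snd z - fst z \<bullet> c) *\<^sub>R fst z - psi (snd z - fst z \<bullet> b) *\<^sub>R fst z)
          \<le> g z * norm (c - b)"
        using elim c b
        by (intro differentiable_bound[OF convex_ball,
              OF has_derivative_at_withinI[OF score_has_derivative]]) auto
      also have "\<dots> \<le> g z * delta"
        using c g0 by (intro mult_left_mono) (auto simp: dist_norm norm_minus_commute)
      finally have "norm (psi (snd z - fst z \<bullet> c) *\<^sub>R fst z) \<le> ?G z"
        by (smt (verit) norm_triangle_sub)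
      then show "norm (- (psi (snd z - fst z \<bullet> c) *\<^sub>R fst z \<bullet> h)) \<le> ?G z * norm h"
        using Cauchy_Schwarz_ineq2[of "psi (snd z - fst z \<bullet> c) *\<^sub>R fst z" h]
        by (simp only: norm_minus_cancel real_norm_def abs_minus_cancel)
          (erule order_trans, rule mult_right_mono, simp_all only: norm_ge_zero)
    qed
  qed
  note loss = has_derivative_integral_dominated[OF open_ball convex_ball measurable_loss
      loss_has_derivative onorm G b dom[unfolded M_domain_def case_prod_beta'] c]
  show "M_domain rho H c"
    using loss(1) by (simp add: M_domain_def case_prod_beta')
  have "integrable H (\<lambda>z. psi (snd z - fst z \<bullet> c) *\<^sub>R fst z)"
    by (rule mean_score(1)[OF b sc c])
  then show "((\<lambda>c. \<integral>(x, y). rho (y - x \<bullet> c) \<partial>H) has_derivative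
      (\<lambda>h. - ((\<integral>(x, y). psi (y - x \<bullet> c) *\<^sub>R x \<partial>H) \<bullet> h))) (at c)"
    using loss(3) by (simp add: case_prod_beta' del: inner_scaleR_left)
qed

text \<open>Minimality is only over the parameters with finite expected loss. These include the whole
  ball, so a minimizer inside the ball is an unconstrained local minimum and the gradient vanishes
  there.\<close>

lemma minimizer_score_equation:
  assumes J: "\<And>t. (J has_real_derivative J' t) (at t)"
    and dom: "M_domain rho H b" and eps: "0 \<le> eps" "eps \<le> 1"
    and c: "c \<in> ball b delta" and min: "is_M_minimizer rho J lam (contaminated H (x0, y0) eps) c"
  shows "(1 - eps) *\<^sub>R (\<integral>(x, y). psi (y - x \<bullet> c) *\<^sub>R x \<partial>H) + eps *\<^sub>R psi (y0 - x0 \<bullet> c) *\<^sub>R x0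
    = (2 * lam) *\<^sub>R (\<chi> j. J' (c $ j))" (is "?s = ?p")
proof -
  have z: "(x0, y0) \<in> space H"
    using sets_eq_imp_space_eq[OF sets_H] by simp
  let ?O = "\<lambda>d. (1 - eps) * (\<integral>(x, y). rho (y - x \<bullet> d) \<partial>H) + eps * rho (y0 - x0 \<bullet> d)
    + 2 * lam * (\<Sum>j\<in>UNIV. J (d $ j))"
  have ball: "M_domain rho (contaminated H (x0, y0) eps) d"
    "M_objective rho J lam (contaminated H (x0, y0) eps) d = ?O d" if "d \<in> ball b delta" for d
    using expected_loss_has_derivative(1)[OF dom that] eps z
    by (simp_all add: M_domain_def M_objective_def integrable_contaminated integral_contaminated)
  have "?O c \<le> ?O d" if "d \<in> ball b delta" for d
    using min ball[OF that] ball(2)[OF c]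
    by (auto simp: is_M_minimizer_def is_arg_min_def not_less)
  then have le: "\<forall>\<^sub>F d in at c. ?O c \<le> ?O d"
    using c by (intro eventually_at_in_open'[THEN eventually_mono, of "ball b delta"]) auto
  have "(?O has_derivative (\<lambda>h. - ((?s - ?p) \<bullet> h))) (at c)"
    by (rule derivative_eq_intros expected_loss_has_derivative(2)[OF dom c]
        DERIV_compose_FDERIV[OF rho] DERIV_compose_FDERIV[OF J]
        bounded_linear_imp_has_derivative[OF bounded_linear_vec_nth] refl)+
      (simp add: fun_eq_iff inner_vec_def[of "\<chi> j. J' (c $ j)"] algebra_simps)
  from fun_cong[OF has_derivative_local_min[OF this le], of "?s - ?p"]
  have "(?s - ?p) \<bullet> (?s - ?p) = 0" by (simp only: neg_equal_0_iff_equal)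
  then have "?s - ?p = 0" by (simp only: inner_eq_zero_iff)
  then show ?thesis by (simp only: right_minus_eq)
qed

end

section \<open>The influence function of the penalized M-functional\<close>

lemma beta_M_minimizes:
  assumes "\<exists>c. is_M_minimizer rho J lam H c"
  shows "is_M_minimizer rho J lam H (beta_M rho J lam H)"
  using assms unfolding is_M_minimizer_def beta_M_def arg_min_def by (rule someI_ex)

lemma componentwise_has_derivative:
  fixes b :: "real^'p"
  assumes "\<And>t. (f has_real_derivative f' t) (at t)"
  shows "((\<lambda>c. \<chi> j. f (c $ j)) has_derivative (\<lambda>h. diag (\<chi> j. f' (b $ j)) *v h)) (at b)"
proof -
  have "((\<lambda>c. \<Sum>j\<in>UNIV. f (c $ j) *\<^sub>R axis j 1 :: real^'p) has_derivative
      (\<lambda>h. \<Sum>j\<in>UNIV. (h $ j * f' (b $ j)) *\<^sub>R axis j 1)) (at b)"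
    by (rule derivative_eq_intros DERIV_compose_FDERIV[OF assms]
        bounded_linear_imp_has_derivative[OF bounded_linear_vec_nth] refl)+ simp
  moreover have "(\<Sum>j\<in>UNIV. v j *\<^sub>R axis j 1 :: real^'p) = (\<chi> j. v j)" for v
    by (simp add: vec_eq_iff axis_def if_distrib cong: if_cong)
  ultimately show ?thesis by (simp add: diag_mult mult.commute)
qed

theorem proposition4p1:
  fixes M :: "'w measure" and X :: "'w \<Rightarrow> real^'p" and e Y :: "'w \<Rightarrow> real"
    and beta0 :: "real^'p" and sigma lam :: real
    and rho psi psi' J J' J'' :: "real \<Rightarrow> real"
    and H0 :: "((real^'p) \<times> real) measure"
    and x0 :: "real^'p" and y0 :: real
    and b :: "real^'p" and eps0 delta :: real and g :: "(real^'p) \<times> real \<Rightarrow> real"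
  assumes "prob_space M"
    and "X \<in> borel_measurable M" and "e \<in> borel_measurable M"
    and independent: "prob_space.indep_set M (sets (vimage_algebra (space M) X borel))
           (sets (vimage_algebra (space M) e borel))"
    and symmetric: "distr M borel (\<lambda>w. - e w) = distr M borel e"
    and "integrable M (\<lambda>w. (e w)\<^sup>2)"
    and centered: "(\<integral>w. e w \<partial>M) = 0"
    and variance: "prob_space.variance M e = sigma\<^sup>2"
    and model: "\<And>w. Y w = X w \<bullet> beta0 + e w"
    and H0: "H0 = distr M borel (\<lambda>w. (X w, Y w))"
    and rho: "\<And>t. (rho has_real_derivative psi t) (at t)"
    and psi: "\<And>t. (psi has_real_derivative psi' t) (at t)"
    and J: "\<And>t. (J has_real_derivative J' t) (at t)"
    and J': "\<And>t. (J' has_real_derivative J'' t) (at t)"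
    and "lam \<ge> 0"
    and b: "b = beta_M rho J lam H0"
    and "eps0 > 0"
    and minimizer: "\<And>eps. 0 \<le> eps \<Longrightarrow> eps < eps0 \<Longrightarrow>
           \<exists>c. is_M_minimizer rho J lam (contaminated H0 (x0, y0) eps) c"
    and continuous: "continuous (at 0 within {0..1})
           (\<lambda>eps. beta_M rho J lam (contaminated H0 (x0, y0) eps))"
    and score: "integrable H0 (\<lambda>(x, y). psi (y - x \<bullet> b) *\<^sub>R x)"
    and "delta > 0" and "integrable H0 g"
    and dominated: "AE (x, y) in H0. \<forall>c\<in>ball b delta. \<bar>psi' (y - x \<bullet> c)\<bar> * (norm x)\<^sup>2 \<le> g (x, y)"
    and nonsingular: "invertible ((\<integral>(x, y). psi' (y - x \<bullet> b) *\<^sub>R outer_square x \<partial>H0)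
                    + (2 * lam) *\<^sub>R diag (\<chi> j. J'' (b $ j)))"
  shows "(\<lambda>eps. beta_M rho J lam (contaminated H0 (x0, y0) eps)) differentiable (at 0 within {0..1})
    \<and> influence_function (beta_M rho J lam) H0 (x0, y0) =
        matrix_inv ((\<integral>(x, y). psi' (y - x \<bullet> b) *\<^sub>R outer_square x \<partial>H0)
                    + (2 * lam) *\<^sub>R diag (\<chi> j. J'' (b $ j)))
        *v (psi (y0 - x0 \<bullet> b) *\<^sub>R x0 - (\<integral>(x, y). psi (y - x \<bullet> b) *\<^sub>R x \<partial>H0))"
proof -
  have sets_H: "sets H0 = sets borel" unfolding H0 by simp
  let ?c = "\<lambda>eps. beta_M rho J lam (contaminated H0 (x0, y0) eps)"
  let ?G = "\<lambda>c. \<integral>(x, y). psi (y - x \<bullet> c) *\<^sub>R x \<partial>H0"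
  let ?s = "\<lambda>c. psi (y0 - x0 \<bullet> c) *\<^sub>R x0"
  let ?P = "\<lambda>c. (2 * lam) *\<^sub>R (\<chi> j. J' (c $ j))"
  let ?B = "\<integral>(x, y). psi' (y - x \<bullet> b) *\<^sub>R outer_square x \<partial>H0"
  let ?A = "?B + (2 * lam) *\<^sub>R diag (\<chi> j. J'' (b $ j))"
  let ?v = "?s b - ?G b"
  note ctx = sets_H rho psi score \<open>delta > 0\<close> \<open>integrable H0 g\<close> dominated
  have c0: "?c 0 = b" by (simp add: b contaminated_zero)
  have min: "is_M_minimizer rho J lam (contaminated H0 (x0, y0) eps) (?c eps)"
    if "0 \<le> eps" "eps < eps0" for eps
    using minimizer[OF that] by (rule beta_M_minimizes)
  \<comment> \<open>The case without contamination: \<open>b\<close> itself is a minimizer.\<close>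
  have dom: "M_domain rho H0 b"
    using min[of 0] \<open>eps0 > 0\<close>
    by (simp add: contaminated_zero is_M_minimizer_def is_arg_min_def flip: b)
  have equation: "(1 - eps) *\<^sub>R ?G (?c eps) + eps *\<^sub>R ?s (?c eps) = ?P (?c eps)"
    if "0 \<le> eps" "eps < eps0" "eps \<le> 1" "?c eps \<in> ball b delta" for eps
    using that by (intro minimizer_score_equation[OF ctx J dom] min) auto
  have lim: "(?c \<longlongrightarrow> b) (at 0 within {0..1})"
    using continuous unfolding continuous_within c0 .
  have G': "(?G has_derivative (\<lambda>h. - (?B *v h))) (at b)"
    by (rule mean_score_has_derivative[OF ctx])
  have "(?c has_vector_derivative - (matrix_inv ?A *v - ?v)) (at 0 within {0..1})"
  proof (rule has_vector_derivative_implicit_root[where K = "\<lambda>c. ?G c - ?P c" and c = ?c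
        and A = "\<lambda>h. - (?A *v h)" and T = "\<lambda>u. - (matrix_inv ?A *v u)"
        and r = "\<lambda>eps. ?G (?c eps) - ?s (?c eps)" and v = "- ?v"])
    have "((\<lambda>c. ?G c - ?P c) has_derivative
        (\<lambda>h. - (?B *v h) - (2 * lam) *\<^sub>R (diag (\<chi> j. J'' (b $ j)) *v h))) (at b)"
      by (intro has_derivative_diff G' has_derivative_scaleR_right componentwise_has_derivative J')
    then show "((\<lambda>c. ?G c - ?P c) has_derivative (\<lambda>h. - (?A *v h))) (at (?c 0))"
      by (simp add: c0 matrix_vector_mult_add_rdistrib scaleR_matrix_vector_assoc)
    show "?G (?c 0) - ?P (?c 0) = 0"
      using equation[of 0] \<open>eps0 > 0\<close> \<open>delta > 0\<close> by (simp add: c0)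
    show "bounded_linear (\<lambda>u. - (matrix_inv ?A *v u))"
      by (intro bounded_linear_minus matrix_vector_mul_bounded_linear)
    show "- (matrix_inv ?A *v - (?A *v h)) = h" for h
      by (simp add: matrix_vector_mult_uminus matrix_inv_mult_left[OF nonsingular])
    show "(?c \<longlongrightarrow> ?c 0) (at 0 within {0..1})" using lim by (simp add: c0)
    have "\<forall>\<^sub>F eps in at 0 within {0..1}. ?c eps \<in> ball b delta"
      using lim \<open>delta > 0\<close> by (intro topological_tendstoD) auto
    moreover have "\<forall>\<^sub>F eps in at (0::real) within {0..1}. 0 \<le> eps \<and> eps \<le> 1 \<and> eps < eps0"
      using \<open>eps0 > 0\<close> by (auto simp: eventually_at intro!: exI[of _ eps0])
    ultimately show "\<forall>\<^sub>F eps in at 0 within {0..1}.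
        ?G (?c eps) - ?P (?c eps) = eps *\<^sub>R (?G (?c eps) - ?s (?c eps))"
    proof eventually_elim
      case (elim eps)
      then show ?case using equation[of eps] by (simp add: algebra_simps)
    qed
    have "isCont (\<lambda>c. psi (y0 - x0 \<bullet> c)) b"
      by (rule isCont_o2[where g = psi]) (auto intro!: continuous_intros DERIV_isCont[OF psi])
    then have "isCont (\<lambda>c. ?G c - ?s c) b"
      using has_derivative_continuous[OF G'] by (intro continuous_intros)
    from isCont_tendsto_compose[OF this lim]
    show "((\<lambda>eps. ?G (?c eps) - ?s (?c eps)) \<longlongrightarrow> - ?v) (at 0 within {0..1})"
      by simp
  qed
  then have D: "(?c has_vector_derivative matrix_inv ?A *v ?v) (at 0 within {0..1})"
    by (simp only: matrix_vector_mult_uminus minus_minus)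
  show ?thesis
    unfolding influence_function_def
    using differentiableI_vector[OF D] vector_derivative_within_closed_interval[OF _ _ D] by simp
qed

end
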